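(* Let $n=m+s$ and consider the system $$\begin{bmatrix}\dot x_a\\ \dot x_u\end{bmatrix}=[J(x)-R(x)]\begin{bmatrix}\nabla_{x_a}\mathcal H(x)\\ \nabla_{x_u}\mathcal H(x)\end{bmatrix}+\begin{bmatrix}u\\ -d_u(x)\end{bmatrix},$$ with $x=\operatorname{col}(x_a,x_u)$, $x_a\in\mathbb R^m$, $x_u\in\mathbb R^s$, $u\in\mathbb R^m$, smooth $\mathcal H:\mathbb R^n\to\mathbb R_+$, and $J=\begin{bmatrix}J_{aa}&J_{au}\\-J_{au}^\top&J_{uu}\end{bmatrix}=-J^\top$, $R=\begin{bmatrix}R_{aa}&R_{au}\\R_{au}^\top&R_{uu}\end{bmatrix}=R^\top\ge0$ (possibly state-dependent). Assume the unmatched disturbance is $d_u(x)=(J_{au}(x)+R_{au}(x))^\top\bar d_u$ for a constant $\bar d_u\in\mathbb R^m$, and that there exists an isolated $\bar x=(\bar x_a,\bar x_u)\in\mathbb R^n$ with $\bar x=\arg\min\mathbf H(x)$, where $\mathbf H(x):=\mathcal H(x)+x_a^\top\bar d_u$. Let $K_i\in\mathbb R^{m\times m}$ be symmetric positive definite, $J_{c_1}(x)=-J_{c_1}^\top(x)$, $R_{c_1}(x)>0$, and close the loop with $$u=[-J_{aa}+R_{aa}+J_{c_1}-R_{c_1}]\nabla_{x_a}\mathcal H+[J_{c_1}-R_{c_1}]K_i(x_a-x_c)+2R_{au}\nabla_{x_u}\mathcal H,$$ $$\dot x_c=(J_{au}+R_{au})\nabla_{x_u}\mathcal H,\qquad x_c\in\mathbb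 R^m$$ (that is, the controller with the parameter $R_{c_2}=0_{m\times m}$), written in the coordinates $w=(w_a,w_u,w_c)=(x_a,x_u,x_a-x_c)$. Then: (i) $\bar w=(\bar x_a,\bar x_u,K_i^{-1}\bar d_u)$ is a stable equilibrium of the closed-loop system; (ii) if the signal $Y_u:=\nabla_{w_a}\mathbf H(w_a,w_u)+K_i(w_c-\bar w_c)$, with $\bar w_c=K_i^{-1}\bar d_u$, is a detectable output of the closed loop, the equilibrium is asymptotically stable; (iii) the stability properties are global if $\mathbf H$ is radially unbounded.
   Context: $\nabla$ denotes the transposed gradient and $\nabla_{x_a},\nabla_{x_u},\nabla_{w_a}$ transposed partial gradients. "Detectable output" means that closed-loop solutions along which the output is identically zero converge to the equilibrium. All functions are smooth. *)

theory Defs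
  imports "HOL-Analysis.Analysis"
begin

inductive_set partials :: "('a::euclidean_space \<Rightarrow> real) \<Rightarrow> ('a \<Rightarrow> real) set"
  for f where
  base: "f \<in> partials f"
| step: "g \<in> partials f \<Longrightarrow> v \<in> Basis \<Longrightarrow>
         (\<lambda>x. frechet_derivative g (at x) v) \<in> partials f"

definition smooth_real :: "('a::euclidean_space \<Rightarrow> real) \<Rightarrow> bool" where
  "smooth_real f \<longleftrightarrow> (\<forall>g\<in>partials f. \<forall>x. g differentiable (at x))"

definition smooth :: "('a::euclidean_space \<Rightarrow> 'b::euclidean_space) \<Rightarrow> bool" where
  "smooth f \<longleftrightarrow> (\<forall>b\<in>Basis. smooth_real (\<lambda>x. f x \<bullet> b))"

definition grad :: "(real^'n \<Rightarrow> real) \<Rightarrow> real^'n \<Rightarrow> real^'n" where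
  "grad f x = (\<chi> i. frechet_derivative f (at x) (axis i 1))"

definition grad_a :: "((real^'m) \<times> (real^'s) \<Rightarrow> real) \<Rightarrow> (real^'m) \<times> (real^'s) \<Rightarrow> real^'m" where
  "grad_a H x = grad (\<lambda>a. H (a, snd x)) (fst x)"

definition grad_u :: "((real^'m) \<times> (real^'s) \<Rightarrow> real) \<Rightarrow> (real^'m) \<times> (real^'s) \<Rightarrow> real^'s" where
  "grad_u H x = grad (\<lambda>v. H (fst x, v)) (snd x)"

definition skew :: "real^'n^'n \<Rightarrow> bool" where
  "skew A \<longleftrightarrow> transpose A = - A"

definition sym_pd :: "real^'n^'n \<Rightarrow> bool" where
  "sym_pd A \<longleftrightarrow> transpose A = A \<and> (\<forall>v. v \<noteq> 0 \<longrightarrow> v \<bullet> (A *v v) > 0)"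

definition pos_def :: "real^'n^'n \<Rightarrow> bool" where
  "pos_def A \<longleftrightarrow> (\<forall>v. v \<noteq> 0 \<longrightarrow> v \<bullet> (A *v v) > 0)"

definition dist_u ::
  "((real^'m) \<times> (real^'s) \<Rightarrow> real^'s^'m) \<Rightarrow> ((real^'m) \<times> (real^'s) \<Rightarrow> real^'s^'m)
   \<Rightarrow> real^'m \<Rightarrow> (real^'m) \<times> (real^'s) \<Rightarrow> real^'s" where
  "dist_u Jau Rau dbar x = transpose (Jau x + Rau x) *v dbar"

definition plant_a ::
  "((real^'m) \<times> (real^'s) \<Rightarrow> real^'m^'m) \<Rightarrow> ((real^'m) \<times> (real^'s) \<Rightarrow> real^'s^'m)
   \<Rightarrow> ((real^'m) \<times> (real^'s) \<Rightarrow> real^'m^'m) \<Rightarrow> ((real^'m) \<times> (real^'s) \<Rightarrow> real^'s^'m)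
   \<Rightarrow> ((real^'m) \<times> (real^'s) \<Rightarrow> real) \<Rightarrow> (real^'m) \<times> (real^'s) \<Rightarrow> real^'m \<Rightarrow> real^'m" where
  "plant_a Jaa Jau Raa Rau H x u =
     (Jaa x - Raa x) *v grad_a H x + (Jau x - Rau x) *v grad_u H x + u"

definition plant_u ::
  "((real^'m) \<times> (real^'s) \<Rightarrow> real^'s^'m) \<Rightarrow> ((real^'m) \<times> (real^'s) \<Rightarrow> real^'s^'s)
   \<Rightarrow> ((real^'m) \<times> (real^'s) \<Rightarrow> real^'s^'m) \<Rightarrow> ((real^'m) \<times> (real^'s) \<Rightarrow> real^'s^'s)
   \<Rightarrow> ((real^'m) \<times> (real^'s) \<Rightarrow> real) \<Rightarrow> real^'m \<Rightarrow> (real^'m) \<times> (real^'s) \<Rightarrow> real^'s" where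
  "plant_u Jau Juu Rau Ruu H dbar x =
     (- transpose (Jau x) - transpose (Rau x)) *v grad_a H x + (Juu x - Ruu x) *v grad_u H x
     - dist_u Jau Rau dbar x"

definition ctrl_u ::
  "((real^'m) \<times> (real^'s) \<Rightarrow> real^'m^'m) \<Rightarrow> ((real^'m) \<times> (real^'s) \<Rightarrow> real^'m^'m)
   \<Rightarrow> ((real^'m) \<times> (real^'s) \<Rightarrow> real^'s^'m)
   \<Rightarrow> ((real^'m) \<times> (real^'s) \<Rightarrow> real^'m^'m) \<Rightarrow> ((real^'m) \<times> (real^'s) \<Rightarrow> real^'m^'m)
   \<Rightarrow> real^'m^'m \<Rightarrow> ((real^'m) \<times> (real^'s) \<Rightarrow> real)
   \<Rightarrow> (real^'m) \<times> (real^'s) \<Rightarrow> real^'m \<Rightarrow> real^'m" where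
  "ctrl_u Jaa Raa Rau Jc1 Rc1 K H x xc =
     (- Jaa x + Raa x + Jc1 x - Rc1 x) *v grad_a H x
     + (Jc1 x - Rc1 x) *v (K *v (fst x - xc))
     + (2::real) *\<^sub>R (Rau x *v grad_u H x)"

definition ctrl_c ::
  "((real^'m) \<times> (real^'s) \<Rightarrow> real^'s^'m) \<Rightarrow> ((real^'m) \<times> (real^'s) \<Rightarrow> real^'s^'m)
   \<Rightarrow> ((real^'m) \<times> (real^'s) \<Rightarrow> real) \<Rightarrow> (real^'m) \<times> (real^'s) \<Rightarrow> real^'m" where
  "ctrl_c Jau Rau H x = (Jau x + Rau x) *v grad_u H x"

definition closed_loop ::
  "((real^'m) \<times> (real^'s) \<Rightarrow> real^'m^'m) \<Rightarrow> ((real^'m) \<times> (real^'s) \<Rightarrow> real^'s^'m)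
   \<Rightarrow> ((real^'m) \<times> (real^'s) \<Rightarrow> real^'s^'s)
   \<Rightarrow> ((real^'m) \<times> (real^'s) \<Rightarrow> real^'m^'m) \<Rightarrow> ((real^'m) \<times> (real^'s) \<Rightarrow> real^'s^'m)
   \<Rightarrow> ((real^'m) \<times> (real^'s) \<Rightarrow> real^'s^'s)
   \<Rightarrow> ((real^'m) \<times> (real^'s) \<Rightarrow> real^'m^'m) \<Rightarrow> ((real^'m) \<times> (real^'s) \<Rightarrow> real^'m^'m)
   \<Rightarrow> real^'m^'m \<Rightarrow> ((real^'m) \<times> (real^'s) \<Rightarrow> real) \<Rightarrow> real^'m
   \<Rightarrow> (real^'m) \<times> (real^'s) \<times> (real^'m) \<Rightarrow> (real^'m) \<times> (real^'s) \<times> (real^'m)" where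
  "closed_loop Jaa Jau Juu Raa Rau Ruu Jc1 Rc1 K H dbar w =
     (let (wa, wu, wc) = w;
          x = (wa, wu);
          xc = wa - wc;
          u = ctrl_u Jaa Raa Rau Jc1 Rc1 K H x xc;
          dxa = plant_a Jaa Jau Raa Rau H x u;
          dxu = plant_u Jau Juu Rau Ruu H dbar x;
          dxc = ctrl_c Jau Rau H x
      in (dxa, dxu, dxa - dxc))"

definition sol_on :: "('a::real_normed_vector \<Rightarrow> 'a) \<Rightarrow> (real \<Rightarrow> 'a) \<Rightarrow> real \<Rightarrow> bool" where
  "sol_on F w T \<longleftrightarrow> T \<ge> 0 \<and>
     (\<forall>t\<in>{0..T}. (w has_vector_derivative F (w t)) (at t within {0..T}))"

definition sol :: "('a::real_normed_vector \<Rightarrow> 'a) \<Rightarrow> (real \<Rightarrow> 'a) \<Rightarrow> bool" where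
  "sol F w \<longleftrightarrow> (\<forall>t\<ge>0. (w has_vector_derivative F (w t)) (at t within {0..}))"

definition equilibrium :: "('a::real_normed_vector \<Rightarrow> 'a) \<Rightarrow> 'a \<Rightarrow> bool" where
  "equilibrium F e \<longleftrightarrow> F e = 0"

definition stable :: "('a::real_normed_vector \<Rightarrow> 'a) \<Rightarrow> 'a \<Rightarrow> bool" where
  "stable F e \<longleftrightarrow> (\<forall>\<epsilon>>0. \<exists>\<delta>>0. \<forall>w T. sol_on F w T \<and> dist (w 0) e < \<delta> \<longrightarrow>
                     (\<forall>t\<in>{0..T}. dist (w t) e < \<epsilon>))"

definition asymp_stable :: "('a::real_normed_vector \<Rightarrow> 'a) \<Rightarrow> 'a \<Rightarrow> bool" where
  "asymp_stable F e \<longleftrightarrow> stable F e \<and>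
     (\<exists>\<delta>>0. \<forall>w. sol F w \<and> dist (w 0) e < \<delta> \<longrightarrow> (w \<longlongrightarrow> e) at_top)"

definition globally_stable :: "('a::real_normed_vector \<Rightarrow> 'a) \<Rightarrow> 'a \<Rightarrow> bool" where
  "globally_stable F e \<longleftrightarrow> stable F e \<and>
     (\<forall>r. \<exists>B. \<forall>w T. sol_on F w T \<and> dist (w 0) e < r \<longrightarrow> (\<forall>t\<in>{0..T}. dist (w t) e < B))"

definition globally_asymp_stable :: "('a::real_normed_vector \<Rightarrow> 'a) \<Rightarrow> 'a \<Rightarrow> bool" where
  "globally_asymp_stable F e \<longleftrightarrow> globally_stable F e \<and>
     (\<forall>w. sol F w \<longrightarrow> (w \<longlongrightarrow> e) at_top)"

definition detectable :: "('a::real_normed_vector \<Rightarrow> 'a) \<Rightarrow> ('a \<Rightarrow> 'b::zero) \<Rightarrow> 'a \<Rightarrow> bool" where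
  "detectable F Y e \<longleftrightarrow>
     (\<forall>w. sol F w \<and> (\<forall>t\<ge>0. Y (w t) = 0) \<longrightarrow> (w \<longlongrightarrow> e) at_top)"

definition radially_unbounded :: "('a::real_normed_vector \<Rightarrow> real) \<Rightarrow> bool" where
  "radially_unbounded f \<longleftrightarrow> filterlim f at_top at_infinity"

end

theory Submission
  imports Defs "HOL-Complex_Analysis.Great_Picard"
begin

text \<open>The closed loop is again port-Hamiltonian, with the Hamiltonian
  \<open>V(w) = \<H>(w\<^sub>a, w\<^sub>u) + w\<^sub>a\<^sup>T dbar + 1/2 (w\<^sub>c - wc_bar)\<^sup>T K (w\<^sub>c - wc_bar)\<close>:
  along solutions \<open>dV/dt = - z\<^sup>T R\<^sub>c\<^sub>1 z - \<nabla>\<^sub>u\<H>\<^sup>T R\<^sub>u\<^sub>u \<nabla>\<^sub>u\<H> \<le> 0\<close>, where \<open>z\<close> is the output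
  \<open>Y\<^sub>u\<close>. Since \<open>V\<close> has a strict global minimum at the equilibrium, Lyapunov's argument
  gives stability. A dissipation-free solution has \<open>Y\<^sub>u = 0\<close>, so detectability makes it
  converge; a LaSalle-type argument on the limits of time shifts of a bounded solution then
  gives attractivity. Radial unboundedness of \<open>\<H> + x\<^sub>a\<^sup>T dbar\<close> makes the sublevel sets of
  \<open>V\<close> bounded, and all conclusions become global.\<close>

section \<open>Solutions of autonomous differential equations\<close>

lemma sol_imp_sol_on:
  assumes "sol F w" "T \<ge> 0"
  shows "sol_on F w T"
  unfolding sol_on_def
proof (intro conjI ballI)
  fix t assume "t \<in> {0..T}"
  then have "(w has_vector_derivative F (w t)) (at t within {0..})"
    using assms unfolding sol_def by auto
  then show "(w has_vector_derivative F (w t)) (at t within {0..T})"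
    by (rule has_vector_derivative_within_subset) auto
qed (use assms in auto)

lemma sol_on_continuous_on: "sol_on F w T \<Longrightarrow> continuous_on {0..T} w"
  unfolding sol_on_def
  by (meson continuous_on_eq_continuous_within has_vector_derivative_continuous)

lemma sol_increment_bound:
  assumes w: "sol F w" and ab: "0 \<le> a" "0 \<le> b"
    and B: "\<And>\<tau>. \<tau> \<in> closed_segment a b \<Longrightarrow> norm (F (w \<tau>) - y) \<le> B"
  shows "norm (w b - w a - (b - a) *\<^sub>R y) \<le> \<bar>b - a\<bar> * B"
proof -
  define g where "g \<tau> = w \<tau> - \<tau> *\<^sub>R y" for \<tau>
  have "norm (g b - g a) \<le> B * norm (b - a)"
  proof (rule differentiable_bound[of "closed_segment a b" g "\<lambda>\<tau> h. h *\<^sub>R (F (w \<tau>) - y)"])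
    fix \<tau> assume \<tau>: "\<tau> \<in> closed_segment a b"
    have "closed_segment a b \<subseteq> {0..}"
      using ab by (auto simp: closed_segment_eq_real_ivl split: if_splits)
    then have "(w has_vector_derivative F (w \<tau>)) (at \<tau> within closed_segment a b)"
      using w \<tau> unfolding sol_def by (meson atLeast_iff has_vector_derivative_within_subset subsetD)
    then have "(g has_vector_derivative F (w \<tau>) - y) (at \<tau> within closed_segment a b)"
      unfolding g_def by (auto intro!: derivative_eq_intros)
    then show "(g has_derivative (\<lambda>h. h *\<^sub>R (F (w \<tau>) - y))) (at \<tau> within closed_segment a b)"
      by (simp add: has_vector_derivative_def)
    show "onorm (\<lambda>h. h *\<^sub>R (F (w \<tau>) - y)) \<le> B"
      using B[OF \<tau>] by (simp add: onorm_scaleR_left onorm_id bounded_linear_ident)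
  qed auto
  then show ?thesis by (simp add: g_def algebra_simps)
qed

lemma bounded_sol_lipschitz:
  fixes F :: "'a::euclidean_space \<Rightarrow> 'a"
  assumes contF: "continuous_on UNIV F" and w: "sol F w"
    and R: "\<And>t. t \<ge> 0 \<Longrightarrow> w t \<in> cball e R"
  obtains G where "G > 0" "\<And>a b. 0 \<le> a \<Longrightarrow> 0 \<le> b \<Longrightarrow> norm (w b - w a) \<le> \<bar>b - a\<bar> * G"
proof -
  have "compact (F ` cball e R)"
    by (rule compact_continuous_image) (auto intro: continuous_on_subset[OF contF])
  then obtain G where G: "G > 0" "\<And>p. p \<in> cball e R \<Longrightarrow> norm (F p) \<le> G"
    using compact_imp_bounded bounded_pos by (metis image_eqI)
  have "norm (w b - w a) \<le> \<bar>b - a\<bar> * G" if ab: "0 \<le> a" "0 \<le> b" for a b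
  proof -
    have "\<tau> \<ge> 0" if "\<tau> \<in> closed_segment a b" for \<tau>
      using that ab by (auto simp: closed_segment_eq_real_ivl split: if_splits)
    then show ?thesis
      using sol_increment_bound[OF w ab, of 0 G] G R by simp
  qed
  with G that show thesis by blast
qed

lemma equilipschitz_convergent_subsequence:
  fixes f :: "nat \<Rightarrow> real \<Rightarrow> 'a::euclidean_space"
  assumes bound: "\<And>n s. s \<ge> 0 \<Longrightarrow> norm (f n s) \<le> B"
    and lipschitz: "\<And>n s t. s \<ge> 0 \<Longrightarrow> t \<ge> 0 \<Longrightarrow> norm (f n t - f n s) \<le> \<bar>t - s\<bar> * G"
    and G: "G > 0"
  obtains k where "strict_mono k" "\<And>s. s \<ge> 0 \<Longrightarrow> convergent (\<lambda>n. f (k n) s)"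
proof -
  obtain k where k: "strict_mono k"
    and conv_rat: "\<And>q. q \<in> \<rat> \<inter> {0..} \<Longrightarrow> \<exists>l. (\<lambda>n. f (k n) q) \<longlonglongrightarrow> l"
    using function_convergent_subsequence[of "\<rat> \<inter> {0..}" f B] countable_rat bound
    by (metis IntD2 atLeast_iff countable_Int1)
  have "Cauchy (\<lambda>n. f (k n) s)" if s: "s \<ge> 0" for s
  proof (rule metric_CauchyI)
    fix \<epsilon> :: real assume "\<epsilon> > 0"
    \<comment> \<open>approximate \<open>s\<close> by a rational \<open>q\<close>, where the subsequence converges\<close>
    obtain q where q: "q \<in> \<rat>" "s < q" "q < s + \<epsilon> / (3 * G)"
      using Rats_dense_in_real[of s "s + \<epsilon> / (3 * G)"] \<open>\<epsilon> > 0\<close> G by auto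
    then obtain l where "(\<lambda>n. f (k n) q) \<longlonglongrightarrow> l" using conv_rat s by force
    then have "Cauchy (\<lambda>n. f (k n) q)" by (rule LIMSEQ_imp_Cauchy)
    then obtain M where M: "\<And>m n. m \<ge> M \<Longrightarrow> n \<ge> M \<Longrightarrow> dist (f (k m) q) (f (k n) q) < \<epsilon> / 3"
      using \<open>\<epsilon> > 0\<close> unfolding Cauchy_def by (meson divide_pos_pos zero_less_numeral)
    have near: "dist (f (k n) s) (f (k n) q) \<le> \<epsilon> / 3" for n
    proof -
      have "dist (f (k n) s) (f (k n) q) \<le> \<bar>q - s\<bar> * G"
        using lipschitz[of s q "k n"] s q by (simp add: dist_norm norm_minus_commute)
      also have "\<dots> \<le> \<epsilon> / (3 * G) * G" using q G by (intro mult_right_mono) auto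
      finally show ?thesis using G by simp
    qed
    show "\<exists>M. \<forall>m\<ge>M. \<forall>n\<ge>M. dist (f (k m) s) (f (k n) s) < \<epsilon>"
    proof (intro exI[of _ M] allI impI)
      fix m n assume "m \<ge> M" "n \<ge> M"
      have "dist (f (k m) s) (f (k n) s)
            \<le> dist (f (k m) s) (f (k m) q) + dist (f (k m) q) (f (k n) q) + dist (f (k n) s) (f (k n) q)"
        using dist_triangle[of "f (k m) s" "f (k n) s" "f (k m) q"]
          dist_triangle[of "f (k m) q" "f (k n) s" "f (k n) q"]
          dist_commute[of "f (k n) s" "f (k n) q"] by linarith
      also have "\<dots> < \<epsilon>" using near[of m] near[of n] M[OF \<open>m \<ge> M\<close> \<open>n \<ge> M\<close>] by linarith
      finally show "dist (f (k m) s) (f (k n) s) < \<epsilon>" .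
    qed
  qed
  with k that show thesis by (simp add: Cauchy_convergent_iff)
qed

lemma bounded_sol_uniformly_differentiable:
  fixes F :: "'a::euclidean_space \<Rightarrow> 'a"
  assumes contF: "continuous_on UNIV F" and w: "sol F w"
    and R: "\<And>t. t \<ge> 0 \<Longrightarrow> w t \<in> cball e R" and "\<epsilon> > 0"
  obtains d where "d > 0" "\<And>a b. 0 \<le> a \<Longrightarrow> 0 \<le> b \<Longrightarrow> \<bar>b - a\<bar> < d \<Longrightarrow>
    norm (w b - w a - (b - a) *\<^sub>R F (w a)) \<le> \<bar>b - a\<bar> * \<epsilon>"
proof -
  obtain G where G: "G > 0" "\<And>a b. 0 \<le> a \<Longrightarrow> 0 \<le> b \<Longrightarrow> norm (w b - w a) \<le> \<bar>b - a\<bar> * G"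
    using bounded_sol_lipschitz[OF contF w R] by blast
  have "uniformly_continuous_on (cball e R) F"
    by (rule compact_uniformly_continuous) (auto intro: continuous_on_subset[OF contF])
  then obtain d where d: "d > 0"
    "\<And>p q. p \<in> cball e R \<Longrightarrow> q \<in> cball e R \<Longrightarrow> dist p q < d \<Longrightarrow> dist (F p) (F q) < \<epsilon>"
    using \<open>\<epsilon> > 0\<close> unfolding uniformly_continuous_on_def by metis
  have "norm (w b - w a - (b - a) *\<^sub>R F (w a)) \<le> \<bar>b - a\<bar> * \<epsilon>"
    if ab: "0 \<le> a" "0 \<le> b" "\<bar>b - a\<bar> < d / G" for a b
  proof (rule sol_increment_bound[OF w ab(1,2)])
    fix \<tau> assume \<tau>: "\<tau> \<in> closed_segment a b"
    then have "\<tau> \<ge> 0" "\<bar>\<tau> - a\<bar> \<le> \<bar>b - a\<bar>"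
      using ab by (auto simp: closed_segment_eq_real_ivl split: if_splits)
    have "norm (w \<tau> - w a) \<le> \<bar>\<tau> - a\<bar> * G" using G(2) ab(1) \<open>\<tau> \<ge> 0\<close> by simp
    also have "\<dots> \<le> \<bar>b - a\<bar> * G"
      using \<open>\<bar>\<tau> - a\<bar> \<le> \<bar>b - a\<bar>\<close> G(1) by (simp add: mult_right_mono)
    also have "\<dots> < d" using ab(3) G(1) by (simp add: pos_less_divide_eq)
    finally show "norm (F (w \<tau>) - F (w a)) \<le> \<epsilon>"
      using d(2)[of "w \<tau>" "w a"] R \<open>\<tau> \<ge> 0\<close> ab(1) by (simp add: dist_norm)
  qed
  moreover have "d / G > 0" using d(1) G(1) by simp
  ultimately show thesis using that by blast
qed

lemma limit_of_shifted_sol_is_sol: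
  fixes F :: "'a::euclidean_space \<Rightarrow> 'a"
  assumes contF: "continuous_on UNIV F" and w: "sol F w"
    and R: "\<And>t. t \<ge> 0 \<Longrightarrow> w t \<in> cball e R"
    and shift: "\<And>n. \<sigma> n \<ge> 0"
    and lim: "\<And>s. s \<ge> 0 \<Longrightarrow> (\<lambda>n. w (\<sigma> n + s)) \<longlonglongrightarrow> v s"
  shows "sol F v"
  unfolding sol_def
proof (intro allI impI)
  fix s :: real assume s: "s \<ge> 0"
  show "(v has_vector_derivative F (v s)) (at s within {0..})"
    unfolding has_vector_derivative_def has_derivative_within_alt
  proof (intro conjI allI impI)
    show "bounded_linear (\<lambda>h. h *\<^sub>R F (v s))" by (rule bounded_linear_scaleR_left)
    fix \<epsilon> :: real assume "\<epsilon> > 0"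
    then obtain d where d: "d > 0" "\<And>a b. 0 \<le> a \<Longrightarrow> 0 \<le> b \<Longrightarrow> \<bar>b - a\<bar> < d \<Longrightarrow>
        norm (w b - w a - (b - a) *\<^sub>R F (w a)) \<le> \<bar>b - a\<bar> * \<epsilon>"
      using bounded_sol_uniformly_differentiable[OF contF w R] by blast
    have "norm (v t - v s - (t - s) *\<^sub>R F (v s)) \<le> \<epsilon> * norm (t - s)"
      if t: "t \<ge> 0" "norm (t - s) < d" for t
    proof -
      have "(\<lambda>n. w (\<sigma> n + t) - w (\<sigma> n + s) - (t - s) *\<^sub>R F (w (\<sigma> n + s)))
            \<longlonglongrightarrow> v t - v s - (t - s) *\<^sub>R F (v s)"
        using lim[of t] lim[of s] s t
        by (intro tendsto_intros isCont_tendsto_compose[where g=F])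
           (auto intro: continuous_on_interior[OF contF])
      moreover have "norm (w (\<sigma> n + t) - w (\<sigma> n + s) - (t - s) *\<^sub>R F (w (\<sigma> n + s)))
          \<le> \<bar>t - s\<bar> * \<epsilon>" for n
        using d(2)[of "\<sigma> n + s" "\<sigma> n + t"] s t shift[of n] by simp
      ultimately have "norm (v t - v s - (t - s) *\<^sub>R F (v s)) \<le> \<bar>t - s\<bar> * \<epsilon>"
        by (intro Lim_norm_ubound[OF trivial_limit_sequentially]) auto
      then show ?thesis by (simp add: mult.commute)
    qed
    with d(1) show "\<exists>d>0. \<forall>t\<in>{0..}. norm (t - s) < d \<longrightarrow>
        norm (v t - v s - (t - s) *\<^sub>R F (v s)) \<le> \<epsilon> * norm (t - s)"
      by auto
  qed
qed

lemma bounded_sol_shifted_limit: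
  fixes F :: "'a::euclidean_space \<Rightarrow> 'a"
  assumes contF: "continuous_on UNIV F" and w: "sol F w"
    and R: "\<And>t. t \<ge> 0 \<Longrightarrow> w t \<in> cball e R"
  obtains k v where "strict_mono k" "sol F v"
    "\<And>s. s \<ge> 0 \<Longrightarrow> (\<lambda>n. w (real (k n) + s)) \<longlonglongrightarrow> v s"
proof -
  obtain G where G: "G > 0" "\<And>a b. 0 \<le> a \<Longrightarrow> 0 \<le> b \<Longrightarrow> norm (w b - w a) \<le> \<bar>b - a\<bar> * G"
    using bounded_sol_lipschitz[OF contF w R] by blast
  have "norm (w t) \<le> norm e + R" if "t \<ge> 0" for t
    using R[OF that] norm_triangle_ineq2[of "w t" e] by (simp add: dist_norm norm_minus_commute)
  then obtain k where k: "strict_mono k" "\<And>s. s \<ge> 0 \<Longrightarrow> convergent (\<lambda>n. w (real (k n) + s))"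
  proof (rule equilipschitz_convergent_subsequence[of "\<lambda>n s. w (real n + s)" "norm e + R" G])
    fix n :: nat and s t :: real assume "s \<ge> 0" "t \<ge> 0"
    then show "norm (w (real n + t) - w (real n + s)) \<le> \<bar>t - s\<bar> * G"
      using G(2)[of "real n + s" "real n + t"] by simp
  qed (use G that in auto)
  define v where "v s = lim (\<lambda>n. w (real (k n) + s))" for s
  have lim: "(\<lambda>n. w (real (k n) + s)) \<longlonglongrightarrow> v s" if "s \<ge> 0" for s
    using k(2)[OF that] unfolding v_def by (simp add: convergent_LIMSEQ_iff)
  have "sol F v" by (rule limit_of_shifted_sol_is_sol[OF contF w R _ lim]) auto
  with k(1) lim that show thesis by blast
qed

section \<open>Lyapunov functions\<close>

lemma nonincreasing_tendsto_Inf: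
  fixes f :: "real \<Rightarrow> real"
  assumes mono: "\<And>s t. 0 \<le> s \<Longrightarrow> s \<le> t \<Longrightarrow> f t \<le> f s"
    and bdd: "bdd_below (f ` {0..})"
  shows "(f \<longlongrightarrow> Inf (f ` {0..})) at_top"
proof (rule order_tendstoI)
  fix a assume "a < Inf (f ` {0..})"
  then have "a < f t" if "t \<ge> 0" for t
    using cInf_lower[OF _ bdd, of "f t"] that by fastforce
  then show "\<forall>\<^sub>F t in at_top. a < f t"
    unfolding eventually_at_top_linorder by blast
next
  fix a assume "Inf (f ` {0..}) < a"
  then obtain t0 where "t0 \<ge> 0" "f t0 < a"
    using cInf_less_iff[OF _ bdd] by auto
  then have "\<forall>t\<ge>t0. f t < a" using mono by (meson le_less_trans)
  then show "\<forall>\<^sub>F t in at_top. f t < a"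
    unfolding eventually_at_top_linorder by blast
qed

locale lyapunov =
  fixes F :: "'a::euclidean_space \<Rightarrow> 'a" and V :: "'a \<Rightarrow> real" and DV :: "'a \<Rightarrow> 'a \<Rightarrow> real"
    and e :: 'a
  assumes F_continuous: "continuous_on UNIV F"
    and V_derivative: "\<And>p. (V has_derivative DV p) (at p)"
    and DV_nonpos: "\<And>p. DV p (F p) \<le> 0"
    and V_strict_min: "\<And>p. p \<noteq> e \<Longrightarrow> V e < V p"
begin

lemma V_continuous_on: "continuous_on S V"
  using V_derivative by (meson continuous_at_imp_continuous_on has_derivative_continuous)

lemma isCont_V: "isCont V p"
  using V_derivative has_derivative_continuous by blast

lemma V_min: "V e \<le> V p"
  using V_strict_min[of p] by (cases "p = e") auto

lemma V_along_has_derivative: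
  assumes "(w has_vector_derivative F (w t)) (at t within S)"
  shows "((\<lambda>t. V (w t)) has_real_derivative DV (w t) (F (w t))) (at t within S)"
proof -
  have "(V \<circ> w has_derivative DV (w t) \<circ> (\<lambda>h. h *\<^sub>R F (w t))) (at t within S)"
  proof (rule diff_chain_within)
    show "(w has_derivative (\<lambda>h. h *\<^sub>R F (w t))) (at t within S)"
      using assms by (simp add: has_vector_derivative_def)
    show "(V has_derivative DV (w t)) (at (w t) within w ` S)"
      using V_derivative by (rule has_derivative_at_withinI)
  qed
  moreover have "DV (w t) \<circ> (\<lambda>h. h *\<^sub>R F (w t)) = (*) (DV (w t) (F (w t)))"
    using linear_cmul[OF has_derivative_linear[OF V_derivative[of "w t"]]]
    by (auto simp: fun_eq_iff)
  ultimately show ?thesis by (simp add: has_field_derivative_def o_def)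
qed

lemma V_along_sol_on_nonincreasing:
  assumes "sol_on F w T" "0 \<le> s" "s \<le> t" "t \<le> T"
  shows "V (w t) \<le> V (w s)"
proof -
  have "\<exists>x\<in>{s..t}. V (w t) - V (w s) = DV (w x) (F (w x)) * (t - s)"
  proof (rule mvt_very_simple[of s t "\<lambda>t. V (w t)"])
    fix x assume "s \<le> x" "x \<le> t"
    then have "(w has_vector_derivative F (w x)) (at x within {s..t})"
      using assms unfolding sol_on_def
      by (meson atLeastAtMost_iff atLeastatMost_subset_iff order_trans has_vector_derivative_within_subset)
    from V_along_has_derivative[OF this]
    show "((\<lambda>t. V (w t)) has_derivative (*) (DV (w x) (F (w x)))) (at x within {s..t})"
      by (simp add: has_field_derivative_def)
  qed (use assms in simp)
  then obtain x where "V (w t) - V (w s) = DV (w x) (F (w x)) * (t - s)" by auto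
  moreover have "DV (w x) (F (w x)) * (t - s) \<le> 0"
    using assms DV_nonpos[of "w x"] by (simp add: mult_nonpos_nonneg)
  ultimately show ?thesis by simp
qed

lemma V_along_sol_nonincreasing: "sol F w \<Longrightarrow> 0 \<le> s \<Longrightarrow> s \<le> t \<Longrightarrow> V (w t) \<le> V (w s)"
  using V_along_sol_on_nonincreasing sol_imp_sol_on by (meson order_trans order_refl)

lemma stable: "stable F e"
  unfolding stable_def
proof (intro allI impI)
  fix \<epsilon> :: real assume "\<epsilon> > 0"
  \<comment> \<open>a level of \<open>V\<close> below its minimum on the sphere of radius \<open>\<epsilon>\<close> cannot be left\<close>
  obtain m where m: "m > V e" "\<And>p. dist p e = \<epsilon> \<Longrightarrow> m \<le> V p"
  proof (cases "sphere e \<epsilon> = {}")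
    case True
    then have "dist p e \<noteq> \<epsilon>" for p by (metis dist_commute empty_iff mem_sphere)
    then show thesis by (intro that[of "V e + 1"]) auto
  next
    case False
    obtain p0 where p0: "p0 \<in> sphere e \<epsilon>" "\<And>p. p \<in> sphere e \<epsilon> \<Longrightarrow> V p0 \<le> V p"
      using continuous_attains_inf[OF compact_sphere False V_continuous_on] by blast
    have "p0 \<noteq> e" using p0(1) \<open>\<epsilon> > 0\<close> by auto
    then have "V e < V p0" by (rule V_strict_min)
    then show thesis using p0 by (intro that[of "V p0"]) (auto simp: dist_commute)
  qed
  obtain d where d: "d > 0" "\<And>p. dist p e < d \<Longrightarrow> dist (V p) (V e) < m - V e"
    using V_continuous_on[of UNIV, unfolded continuous_on_iff] m(1)
    by (metis UNIV_I diff_gt_0_iff_gt)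
  show "\<exists>\<delta>>0. \<forall>w T. sol_on F w T \<and> dist (w 0) e < \<delta> \<longrightarrow> (\<forall>t\<in>{0..T}. dist (w t) e < \<epsilon>)"
  proof (intro exI[of _ "min d \<epsilon>"] conjI allI impI ballI)
    show "min d \<epsilon> > 0" using d \<open>\<epsilon> > 0\<close> by simp
    fix w T t assume w: "sol_on F w T \<and> dist (w 0) e < min d \<epsilon>" and t: "t \<in> {0..T}"
    show "dist (w t) e < \<epsilon>"
    proof (rule ccontr)
      assume "\<not> dist (w t) e < \<epsilon>"
      have "continuous_on {0..t} (\<lambda>s. dist (w s) e)"
        using sol_on_continuous_on[of F w T] w t
        by (intro continuous_intros) (auto elim: continuous_on_subset)
      then obtain s where s: "0 \<le> s" "s \<le> t" "dist (w s) e = \<epsilon>"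
        using IVT'[of "\<lambda>s. dist (w s) e" 0 \<epsilon> t] w t \<open>\<not> dist (w t) e < \<epsilon>\<close> by auto
      have "m \<le> V (w s)" using m(2) s(3) by blast
      also have "V (w s) \<le> V (w 0)" using V_along_sol_on_nonincreasing[of w T 0 s] w s t by auto
      also have "V (w 0) < m" using d(2)[of "w 0"] w by (auto simp: dist_real_def)
      finally show False by simp
    qed
  qed
qed

definition dissipation_detectable :: bool where
  "dissipation_detectable \<longleftrightarrow>
     (\<forall>v. sol F v \<and> (\<forall>t\<ge>0. DV (v t) (F (v t)) = 0) \<longrightarrow> (v \<longlongrightarrow> e) at_top)"

lemma DV_zero_if_V_constant_along_sol:
  assumes v: "sol F v" and const: "\<And>s. s \<ge> 0 \<Longrightarrow> V (v s) = c" and s: "s \<ge> 0"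
  shows "DV (v s) (F (v s)) = 0"
proof -
  have "((\<lambda>t. V (v t)) has_vector_derivative DV (v s) (F (v s))) (at s within {0..})"
    using V_along_has_derivative v s unfolding sol_def
    by (simp add: has_real_derivative_iff_has_vector_derivative)
  moreover have "((\<lambda>t. V (v t)) has_vector_derivative 0) (at s within {0..})"
    by (rule has_vector_derivative_transform[OF _ _ has_vector_derivative_const[of c]])
       (use s const in auto)
  moreover have "at_right s \<le> at s within {0..}" using s by (intro at_le) auto
  then have "at s within {0..} \<noteq> bot"
    using trivial_limit_at_right_real by (metis bot.extremum_uniqueI)
  ultimately show ?thesis using vector_derivative_unique_within by blast
qed

lemma tendsto_if_V_tendsto_min:
  fixes w :: "real \<Rightarrow> 'a"
  assumes R: "\<And>t. t \<ge> 0 \<Longrightarrow> w t \<in> cball e R"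
    and lim: "((\<lambda>t. V (w t)) \<longlongrightarrow> V e) at_top"
  shows "(w \<longlongrightarrow> e) at_top"
  unfolding tendsto_iff
proof (intro allI impI)
  fix \<epsilon> :: real assume "\<epsilon> > 0"
  define C where "C = cball e R \<inter> {p. \<epsilon> \<le> dist p e}"
  have "compact C" unfolding C_def
    by (intro compact_Int_closed compact_cball closed_Collect_le continuous_intros)
  have "\<exists>m > V e. \<forall>p\<in>C. m \<le> V p"
  proof (cases "C = {}")
    case False
    then obtain p0 where p0: "p0 \<in> C" "\<And>p. p \<in> C \<Longrightarrow> V p0 \<le> V p"
      using continuous_attains_inf[OF \<open>compact C\<close> _ V_continuous_on] by blast
    have "p0 \<noteq> e" using p0(1) \<open>\<epsilon> > 0\<close> by (auto simp: C_def)
    then show ?thesis using p0 V_strict_min by blast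
  qed (auto intro: gt_ex)
  then obtain m where m: "m > V e" "\<And>p. p \<in> C \<Longrightarrow> m \<le> V p" by blast
  have "\<forall>\<^sub>F t in at_top. t \<ge> 0 \<and> V (w t) < m"
    by (rule eventually_conj[OF eventually_ge_at_top[of 0] order_tendstoD(2)[OF lim m(1)]])
  then show "\<forall>\<^sub>F t in at_top. dist (w t) e < \<epsilon>"
  proof eventually_elim
    case (elim t)
    then have "w t \<notin> C" using m(2) by fastforce
    then show ?case using R elim by (auto simp: C_def)
  qed
qed

text \<open>LaSalle's invariance principle, with the detectability of the dissipation in place of
  the invariance argument: the time shifts of a bounded solution accumulate at a solution on
  which \<open>V\<close> is constant, hence dissipation-free.\<close>

lemma bounded_sol_tendsto:
  assumes det: dissipation_detectable and w: "sol F w"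
    and R: "\<And>t. t \<ge> 0 \<Longrightarrow> w t \<in> cball e R"
  shows "(w \<longlongrightarrow> e) at_top"
proof -
  define c where "c = Inf ((\<lambda>t. V (w t)) ` {0..})"
  have Vw_lim: "((\<lambda>t. V (w t)) \<longlongrightarrow> c) at_top"
    unfolding c_def using V_along_sol_nonincreasing[OF w] V_min
    by (intro nonincreasing_tendsto_Inf bdd_belowI[where m="V e"]) auto
  obtain k v where k: "strict_mono k" and v: "sol F v"
    and v_lim: "\<And>s. s \<ge> 0 \<Longrightarrow> (\<lambda>n. w (real (k n) + s)) \<longlonglongrightarrow> v s"
    using bounded_sol_shifted_limit[OF F_continuous w R] by blast
  have Vv: "V (v s) = c" if "s \<ge> 0" for s
  proof (rule LIMSEQ_unique)
    show "(\<lambda>n. V (w (real (k n) + s))) \<longlonglongrightarrow> V (v s)"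
      using v_lim[OF that] by (intro isCont_tendsto_compose[where g=V] isCont_V)
    have "filterlim (\<lambda>n. real (k n)) at_top sequentially"
      using filterlim_compose[OF filterlim_real_sequentially filterlim_subseq[OF k]] by (simp add: o_def)
    then have "filterlim (\<lambda>n. real (k n) + s) at_top sequentially"
      using filterlim_tendsto_add_at_top[OF tendsto_const] by (simp add: add.commute)
    then show "(\<lambda>n. V (w (real (k n) + s))) \<longlonglongrightarrow> c"
      using filterlim_compose[OF Vw_lim] by blast
  qed
  have "(v \<longlongrightarrow> e) at_top"
    using det v DV_zero_if_V_constant_along_sol[OF v Vv] unfolding dissipation_detectable_def
    by blast
  then have "((\<lambda>t. V (v t)) \<longlongrightarrow> V e) at_top"
    by (intro isCont_tendsto_compose[where g=V] isCont_V)
  moreover have "((\<lambda>t. V (v t)) \<longlongrightarrow> c) at_top"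
    using Vv by (intro tendsto_eventually) (auto simp: eventually_at_top_linorder)
  ultimately have "c = V e" using tendsto_unique[OF trivial_limit_at_top_linorder] by metis
  with Vw_lim have "((\<lambda>t. V (w t)) \<longlongrightarrow> V e) at_top" by simp
  then show ?thesis using tendsto_if_V_tendsto_min[of w R] R by blast
qed

lemma asymp_stable:
  assumes dissipation_detectable
  shows "asymp_stable F e"
  unfolding asymp_stable_def
proof (intro conjI stable)
  obtain \<delta> where \<delta>: "\<delta> > 0"
    "\<And>w T. sol_on F w T \<and> dist (w 0) e < \<delta> \<Longrightarrow> \<forall>t\<in>{0..T}. dist (w t) e < 1"
    using stable unfolding stable_def by (meson zero_less_one)
  have "(w \<longlongrightarrow> e) at_top" if w: "sol F w" "dist (w 0) e < \<delta>" for w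
  proof (rule bounded_sol_tendsto[OF assms w(1)])
    fix t :: real assume "t \<ge> 0"
    then show "w t \<in> cball e 1"
      using \<delta>(2)[of w t] sol_imp_sol_on[OF w(1)] w(2) by (force simp: dist_commute)
  qed
  with \<delta>(1) show "\<exists>\<delta>>0. \<forall>w. sol F w \<and> dist (w 0) e < \<delta> \<longrightarrow> (w \<longlongrightarrow> e) at_top" by blast
qed

lemma globally_stable:
  assumes sublevel: "\<And>M. bounded {p. V p \<le> M}"
  shows "globally_stable F e"
  unfolding globally_stable_def
proof (intro conjI stable allI)
  fix r :: real
  obtain M where M: "\<And>p. dist p e < r \<Longrightarrow> V p \<le> M"
  proof (cases "r > 0")
    case True
    then obtain p0 where "\<And>p. p \<in> cball e r \<Longrightarrow> V p \<le> V p0"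
      using continuous_attains_sup[OF compact_cball _ V_continuous_on, of e r] by fastforce
    then show thesis by (intro that[of "V p0"]) (auto simp: dist_commute)
  next
    case False
    then show thesis by (intro that[of 0]) (meson less_le_trans not_less zero_le_dist)
  qed
  obtain B where "{p. V p \<le> M} \<subseteq> ball e B" using bounded_subset_ballD[OF sublevel] by blast
  moreover have "V (w t) \<le> M" if "sol_on F w T" "dist (w 0) e < r" "t \<in> {0..T}" for w T t
    using V_along_sol_on_nonincreasing[of w T 0 t] M[of "w 0"] that by fastforce
  ultimately have "dist (w t) e < B" if "sol_on F w T" "dist (w 0) e < r" "t \<in> {0..T}" for w T t
    using that by (fastforce simp: dist_commute)
  then show "\<exists>B. \<forall>w T. sol_on F w T \<and> dist (w 0) e < r \<longrightarrow> (\<forall>t\<in>{0..T}. dist (w t) e < B)"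
    by blast
qed

lemma globally_asymp_stable:
  assumes sublevel: "\<And>M. bounded {p. V p \<le> M}" and det: dissipation_detectable
  shows "globally_asymp_stable F e"
  unfolding globally_asymp_stable_def
proof (intro conjI globally_stable[OF sublevel] allI impI)
  fix w assume w: "sol F w"
  obtain R where "{p. V p \<le> V (w 0)} \<subseteq> ball e R" using bounded_subset_ballD[OF sublevel] by blast
  then have "w t \<in> cball e R" if "t \<ge> 0" for t
    using V_along_sol_nonincreasing[OF w, of 0 t] that by auto
  then show "(w \<longlongrightarrow> e) at_top" by (rule bounded_sol_tendsto[OF det w])
qed

end

lemma smooth_real_differentiable: "smooth_real f \<Longrightarrow> f differentiable (at x)"
  unfolding smooth_real_def by (auto intro: partials.base)

lemma smooth_real_partial_continuous:
  assumes "smooth_real f" "b \<in> Basis"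
  shows "continuous_on UNIV (\<lambda>x. frechet_derivative f (at x) b)"
proof -
  have "(\<lambda>x. frechet_derivative f (at x) b) \<in> partials f"
    using assms(2) by (auto intro: partials.intros)
  then show ?thesis using assms(1) unfolding smooth_real_def
    by (meson continuous_at_imp_continuous_on differentiable_imp_continuous_within)
qed

lemma smooth_imp_smooth_real: "smooth f \<Longrightarrow> smooth_real f" for f :: "'a::euclidean_space \<Rightarrow> real"
  unfolding smooth_def by simp

lemma smooth_continuous_on:
  fixes f :: "'a::euclidean_space \<Rightarrow> 'b::euclidean_space"
  assumes "smooth f"
  shows "continuous_on S f"
proof -
  have "continuous_on UNIV (\<lambda>x. f x \<bullet> b)" if "b \<in> Basis" for b
    using assms that smooth_real_differentiable unfolding smooth_def
    by (meson continuous_at_imp_continuous_on differentiable_imp_continuous_within)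
  then have "continuous_on UNIV f" using continuous_on_componentwise[of UNIV f] by blast
  then show ?thesis by (rule continuous_on_subset) simp
qed

lemma linear_eq_inner_axis:
  fixes L :: "real^'n \<Rightarrow> real"
  assumes "linear L"
  shows "L h = h \<bullet> (\<chi> i. L (axis i 1))"
proof -
  have "L h = L (\<Sum>i\<in>UNIV. h $ i *\<^sub>R axis i 1)"
    using basis_expansion[of h] by (simp add: scalar_mult_eq_scaleR)
  also have "\<dots> = (\<Sum>i\<in>UNIV. h $ i * L (axis i 1))"
    using assms by (simp add: linear_sum linear_scale)
  finally show ?thesis by (simp add: inner_vec_def)
qed

context
  fixes H :: "(real^'m) \<times> (real^'s) \<Rightarrow> real" and x :: "(real^'m) \<times> (real^'s)"
  assumes H_differentiable: "H differentiable (at x)"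
begin

lemma grad_a_eq_frechet_derivative: "grad_a H x = (\<chi> i. frechet_derivative H (at x) (axis i 1, 0))"
proof -
  have "((\<lambda>a. (a, snd x)) has_derivative (\<lambda>h. (h, 0))) (at (fst x))"
    by (auto intro!: derivative_eq_intros)
  moreover have "(H has_derivative frechet_derivative H (at x)) (at (fst x, snd x))"
    using frechet_derivative_works[THEN iffD1, OF H_differentiable] by simp
  ultimately have "((\<lambda>a. H (a, snd x)) has_derivative (\<lambda>h. frechet_derivative H (at x) (h, 0))) (at (fst x))"
    by (rule has_derivative_compose)
  then show ?thesis unfolding grad_a_def grad_def by (simp add: frechet_derivative_at[symmetric])
qed

lemma grad_u_eq_frechet_derivative: "grad_u H x = (\<chi> j. frechet_derivative H (at x) (0, axis j 1))"
proof -
  have "((\<lambda>v. (fst x, v)) has_derivative (\<lambda>h. (0, h))) (at (snd x))"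
    by (auto intro!: derivative_eq_intros)
  moreover have "(H has_derivative frechet_derivative H (at x)) (at (fst x, snd x))"
    using frechet_derivative_works[THEN iffD1, OF H_differentiable] by simp
  ultimately have "((\<lambda>v. H (fst x, v)) has_derivative (\<lambda>h. frechet_derivative H (at x) (0, h))) (at (snd x))"
    by (rule has_derivative_compose)
  then show ?thesis unfolding grad_u_def grad_def by (simp add: frechet_derivative_at[symmetric])
qed

lemma frechet_derivative_eq_grad:
  "frechet_derivative H (at x) (ha, hu) = ha \<bullet> grad_a H x + hu \<bullet> grad_u H x"
proof -
  let ?D = "frechet_derivative H (at x)"
  have D: "linear ?D"
    using H_differentiable frechet_derivative_works has_derivative_linear by blast
  have "linear (\<lambda>h::real^'m. (h, 0::real^'s))" "linear (\<lambda>h::real^'s. (0::real^'m, h))"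
    by (auto simp: linear_iff)
  then have "linear (\<lambda>h. ?D (h, 0))" "linear (\<lambda>h. ?D (0, h))"
    using linear_compose[OF _ D] by (auto simp: o_def)
  then have "?D (ha, 0) = ha \<bullet> grad_a H x" "?D (0, hu) = hu \<bullet> grad_u H x"
    using linear_eq_inner_axis[of "\<lambda>h. ?D (h, 0)" ha] linear_eq_inner_axis[of "\<lambda>h. ?D (0, h)" hu]
    by (simp_all add: grad_a_eq_frechet_derivative grad_u_eq_frechet_derivative)
  moreover have "?D (ha, hu) = ?D (ha, 0) + ?D (0, hu)"
    using linear_add[OF D, of "(ha, 0)" "(0, hu)"] by simp
  ultimately show ?thesis by simp
qed

end

lemma grad_a_continuous_on:
  assumes "smooth_real H"
  shows "continuous_on S (grad_a H)"
proof -
  have "grad_a H = (\<lambda>x. \<chi> i. frechet_derivative H (at x) (axis i 1, 0))"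
    using grad_a_eq_frechet_derivative[OF smooth_real_differentiable[OF assms]] by (simp add: fun_eq_iff)
  moreover have "continuous_on S (\<lambda>x. \<chi> i. frechet_derivative H (at x) (axis i 1, 0))"
    by (intro continuous_intros continuous_on_subset[OF smooth_real_partial_continuous[OF assms]])
      (auto simp: Basis_prod_def)
  ultimately show ?thesis by simp
qed

lemma grad_u_continuous_on:
  assumes "smooth_real H"
  shows "continuous_on S (grad_u H)"
proof -
  have "grad_u H = (\<lambda>x. \<chi> j. frechet_derivative H (at x) (0, axis j 1))"
    using grad_u_eq_frechet_derivative[OF smooth_real_differentiable[OF assms]] by (simp add: fun_eq_iff)
  moreover have "continuous_on S (\<lambda>x. \<chi> j. frechet_derivative H (at x) (0, axis j 1))"
    by (intro continuous_intros continuous_on_subset[OF smooth_real_partial_continuous[OF assms]])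
      (auto simp: Basis_prod_def)
  ultimately show ?thesis by simp
qed

lemma matrix_vector_mult_uminus: "(- A) *v x = - (A *v x)" for A :: "real^'n^'m"
  by (simp add: matrix_vector_mult_def vec_eq_iff sum_negf)

lemma inner_transpose_mult: "x \<bullet> (transpose A *v y) = (A *v x) \<bullet> y" for A :: "real^'n^'m"
  by (metis dot_lmul_matrix inner_commute transpose_matrix_vector)

lemma skew_quadratic_form: "skew A \<Longrightarrow> x \<bullet> (A *v x) = 0"
  using inner_transpose_mult[of x A x] unfolding skew_def
  by (simp add: matrix_vector_mult_uminus inner_commute)

lemma sym_pd_iff: "sym_pd A \<longleftrightarrow> transpose A = A \<and> pos_def A"
  unfolding sym_pd_def pos_def_def ..

lemma pos_def_quadratic_form_nonneg: "pos_def A \<Longrightarrow> 0 \<le> x \<bullet> (A *v x)"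
  unfolding pos_def_def by (cases "x = 0") (auto intro: less_imp_le)

lemma pos_def_quadratic_form_eq_0_iff: "pos_def A \<Longrightarrow> x \<bullet> (A *v x) = 0 \<longleftrightarrow> x = 0"
  unfolding pos_def_def by (metis inner_zero_left less_irrefl)

lemma pos_def_quadratic_form_lower_bound:
  assumes "pos_def A"
  obtains l where "l > 0" "\<And>x. l * (norm x)\<^sup>2 \<le> x \<bullet> (A *v x)"
proof -
  have "sphere (0::real^'n) 1 \<noteq> {}"
    using vector_choose_size[of 1] by (auto simp: sphere_def)
  moreover have "continuous_on (sphere 0 1) (\<lambda>x. x \<bullet> (A *v x))" by (intro continuous_intros)
  ultimately obtain u where u: "u \<in> sphere 0 1" "\<And>x. x \<in> sphere 0 1 \<Longrightarrow> u \<bullet> (A *v u) \<le> x \<bullet> (A *v x)"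
    using continuous_attains_inf[OF compact_sphere] by blast
  have "u \<noteq> 0" using u(1) by auto
  then have "0 < u \<bullet> (A *v u)" using assms unfolding pos_def_def by blast
  moreover have "u \<bullet> (A *v u) * (norm x)\<^sup>2 \<le> x \<bullet> (A *v x)" for x
  proof (cases "x = 0")
    case False
    then have "u \<bullet> (A *v u) \<le> (x /\<^sub>R norm x) \<bullet> (A *v (x /\<^sub>R norm x))" by (intro u(2)) simp
    also have "\<dots> = (x \<bullet> (A *v x)) / (norm x)\<^sup>2"
      by (simp add: matrix_vector_mult_scaleR power2_eq_square field_simps)
    finally show ?thesis using False by (simp add: pos_le_divide_eq)
  qed simp
  ultimately show thesis using that by blast
qed

lemma sym_pd_mult_matrix_inv: "sym_pd A \<Longrightarrow> A *v (matrix_inv A *v y) = y"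
proof -
  assume "sym_pd A"
  then have "\<forall>x. A *v x = 0 \<longrightarrow> x = 0" unfolding sym_pd_def by (metis inner_zero_right less_irrefl)
  then obtain B where "B ** A = mat 1" using matrix_left_invertible_ker by blast
  then have "A ** B = mat 1 \<and> B ** A = mat 1" using matrix_left_right_inverse by blast
  then have "A ** matrix_inv A = mat 1" unfolding matrix_inv_def by (rule someI2) simp
  then show ?thesis by (simp add: matrix_vector_mul_assoc)
qed

lemma continuous_on_matrix_vector_mult [continuous_intros]:
  fixes A :: "'a::topological_space \<Rightarrow> real^'n^'m"
  shows "continuous_on S A \<Longrightarrow> continuous_on S v \<Longrightarrow> continuous_on S (\<lambda>x. A x *v v x)"
  unfolding matrix_vector_mult_def by (intro continuous_intros)

lemma continuous_on_transpose [continuous_intros]: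
  fixes A :: "'a::topological_space \<Rightarrow> real^'n^'m"
  shows "continuous_on S A \<Longrightarrow> continuous_on S (\<lambda>x. transpose (A x))"
  unfolding transpose_def by (intro continuous_intros)

lemma continuous_on_compose_plant_state:
  "continuous_on UNIV f \<Longrightarrow> continuous_on S (\<lambda>w. f (fst w, fst (snd w)))"
  by (rule continuous_on_compose2[of UNIV f]) (auto intro!: continuous_intros)

section \<open>The closed loop\<close>

lemma closed_loop_eq:
  "closed_loop Jaa Jau Juu Raa Rau Ruu Jc1 Rc1 K H dbar (wa, wu, wc) =
    ((Jc1 (wa, wu) - Rc1 (wa, wu)) *v (grad_a H (wa, wu) + K *v wc)
       + (Jau (wa, wu) + Rau (wa, wu)) *v grad_u H (wa, wu),
     - (transpose (Jau (wa, wu) + Rau (wa, wu)) *v (grad_a H (wa, wu) + dbar))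
       + (Juu (wa, wu) - Ruu (wa, wu)) *v grad_u H (wa, wu),
     (Jc1 (wa, wu) - Rc1 (wa, wu)) *v (grad_a H (wa, wu) + K *v wc))"
  unfolding closed_loop_def plant_a_def plant_u_def ctrl_u_def ctrl_c_def dist_u_def
  by (simp add: Let_def algebra_simps matrix_vector_mult_uminus scaleR_2)

locale closed_loop_system =
  fixes H :: "(real^'m) \<times> (real^'s) \<Rightarrow> real"
    and Jaa Raa Jc1 Rc1 :: "(real^'m) \<times> (real^'s) \<Rightarrow> real^'m^'m"
    and Jau Rau :: "(real^'m) \<times> (real^'s) \<Rightarrow> real^'s^'m"
    and Juu Ruu :: "(real^'m) \<times> (real^'s) \<Rightarrow> real^'s^'s"
    and K :: "real^'m^'m"
    and dbar :: "real^'m"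
    and xbar :: "(real^'m) \<times> (real^'s)"
  assumes H_smooth: "smooth H"
    and smooth_J: "smooth Jaa" "smooth Jau" "smooth Juu"
    and smooth_R: "smooth Raa" "smooth Rau" "smooth Ruu"
    and smooth_c: "smooth Jc1" "smooth Rc1"
    and J_skew: "\<forall>x. skew (Jaa x) \<and> skew (Juu x)"
    and R_psd: "\<forall>x va vu. va \<bullet> (Raa x *v va) + va \<bullet> (Rau x *v vu)
                         + vu \<bullet> (transpose (Rau x) *v va) + vu \<bullet> (Ruu x *v vu) \<ge> 0"
    and argmin: "{x. \<forall>y. H x + fst x \<bullet> dbar \<le> H y + fst y \<bullet> dbar} = {xbar}"
    and K_pd: "sym_pd K"
    and Jc1_skew: "\<forall>x. skew (Jc1 x)"
    and Rc1_pd: "\<forall>x. pos_def (Rc1 x)"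
begin

abbreviation F where "F \<equiv> closed_loop Jaa Jau Juu Raa Rau Ruu Jc1 Rc1 K H dbar"

definition HH :: "(real^'m) \<times> (real^'s) \<Rightarrow> real" where
  "HH x = H x + fst x \<bullet> dbar"

definition wc_bar :: "real^'m" where
  "wc_bar = matrix_inv K *v dbar"

definition wbar :: "(real^'m) \<times> (real^'s) \<times> (real^'m)" where
  "wbar = (fst xbar, snd xbar, wc_bar)"

text \<open>The shifted Hamiltonian plus the energy stored in the integral action.\<close>

definition V :: "(real^'m) \<times> (real^'s) \<times> (real^'m) \<Rightarrow> real" where
  "V w = HH (fst w, fst (snd w))
     + (1/2) * ((snd (snd w) - wc_bar) \<bullet> (K *v (snd (snd w) - wc_bar)))"

definition DV :: "(real^'m) \<times> (real^'s) \<times> (real^'m) \<Rightarrow> (real^'m) \<times> (real^'s) \<times> (real^'m) \<Rightarrow> real"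
  where
  "DV w h = fst h \<bullet> (grad_a H (fst w, fst (snd w)) + dbar)
     + fst (snd h) \<bullet> grad_u H (fst w, fst (snd w)) + snd (snd h) \<bullet> (K *v (snd (snd w) - wc_bar))"

lemma H_differentiable: "H differentiable (at x)"
  using H_smooth by (intro smooth_real_differentiable smooth_imp_smooth_real)

lemma HH_has_derivative:
  "(HH has_derivative (\<lambda>h. fst h \<bullet> (grad_a H x + dbar) + snd h \<bullet> grad_u H x)) (at x)"
proof -
  have "(H has_derivative frechet_derivative H (at x)) (at x)"
    using H_differentiable frechet_derivative_works by blast
  then show ?thesis unfolding HH_def fun_eq_iff
    by (auto intro!: derivative_eq_intros
        simp: frechet_derivative_eq_grad[OF H_differentiable, symmetric] inner_add_right inner_commute)
qed

lemma grad_a_HH: "grad_a HH x = grad_a H x + dbar"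
proof -
  have "((\<lambda>a. (a, snd x)) has_derivative (\<lambda>h. (h, 0))) (at (fst x))"
    by (auto intro!: derivative_eq_intros)
  moreover have "(HH has_derivative (\<lambda>h. fst h \<bullet> (grad_a H x + dbar) + snd h \<bullet> grad_u H x))
      (at (fst x, snd x))"
    using HH_has_derivative by simp
  ultimately have D: "((\<lambda>a. HH (a, snd x)) has_derivative (\<lambda>h. h \<bullet> (grad_a H x + dbar))) (at (fst x))"
    using has_derivative_compose by fastforce
  show ?thesis
    unfolding grad_a_def grad_def frechet_derivative_at[OF D, symmetric]
    by (simp add: vec_eq_iff inner_axis' inner_commute)
qed

lemma HH_min: "HH xbar \<le> HH y"
  using argmin unfolding HH_def by blast

lemma HH_strict_min: "y \<noteq> xbar \<Longrightarrow> HH xbar < HH y"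
proof (rule ccontr)
  assume "y \<noteq> xbar" "\<not> HH xbar < HH y"
  then have "\<forall>z. HH y \<le> HH z" using HH_min by (meson not_less order_trans)
  then have "y \<in> {xbar}" using argmin unfolding HH_def by blast
  with \<open>y \<noteq> xbar\<close> show False by simp
qed

lemma grad_at_xbar: "grad_a H xbar = - dbar" "grad_u H xbar = 0"
proof -
  have "(\<lambda>h. fst h \<bullet> (grad_a H xbar + dbar) + snd h \<bullet> grad_u H xbar) = (\<lambda>h. 0)"
    by (rule has_derivative_local_min[OF HH_has_derivative]) (auto intro: always_eventually HH_min)
  then have "(grad_a H xbar + dbar) \<bullet> (grad_a H xbar + dbar) = 0" "grad_u H xbar \<bullet> grad_u H xbar = 0"
    by (auto dest: fun_cong[of _ _ "(grad_a H xbar + dbar, 0)"] fun_cong[of _ _ "(0, grad_u H xbar)"])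
  then show "grad_a H xbar = - dbar" "grad_u H xbar = 0"
    by (simp_all add: eq_neg_iff_add_eq_0)
qed

lemma K_sym: "transpose K = K" and K_pos_def: "pos_def K"
  using K_pd by (simp_all add: sym_pd_iff)

lemma K_wc_bar: "K *v wc_bar = dbar"
  unfolding wc_bar_def using K_pd by (rule sym_pd_mult_matrix_inv)

lemma V_Pair: "V (wa, wu, wc) = HH (wa, wu) + (1/2) * ((wc - wc_bar) \<bullet> (K *v (wc - wc_bar)))"
  by (simp add: V_def)

lemma V_has_derivative: "(V has_derivative DV w) (at w)"
proof -
  define x where "x = (fst w, fst (snd w))"
  define q where "q = snd (snd w) - wc_bar"
  have "((\<lambda>w. (fst w, fst (snd w))) has_derivative (\<lambda>h. (fst h, fst (snd h)))) (at w)"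
    by (auto intro!: derivative_eq_intros)
  from has_derivative_compose[OF this HH_has_derivative[of x, unfolded x_def]]
  have HH': "((\<lambda>w. HH (fst w, fst (snd w))) has_derivative
      (\<lambda>h. fst h \<bullet> (grad_a H x + dbar) + fst (snd h) \<bullet> grad_u H x)) (at w)"
    by (simp add: x_def)
  have q': "((\<lambda>w. snd (snd w) - wc_bar) has_derivative (\<lambda>h. snd (snd h))) (at w)"
    by (auto intro!: derivative_eq_intros)
  have "((\<lambda>w. (snd (snd w) - wc_bar) \<bullet> (K *v (snd (snd w) - wc_bar))) has_derivative
      (\<lambda>h. q \<bullet> (K *v snd (snd h)) + snd (snd h) \<bullet> (K *v q))) (at w)"
    unfolding q_def
    by (rule has_derivative_inner[OF q' bounded_linear.has_derivative[OF matrix_vector_mul_bounded_linear q']])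
  moreover have "q \<bullet> (K *v h) = h \<bullet> (K *v q)" for h
    using inner_transpose_mult[of q K h] by (simp add: K_sym inner_commute)
  ultimately have quad': "((\<lambda>w. (1/2) * ((snd (snd w) - wc_bar) \<bullet> (K *v (snd (snd w) - wc_bar))))
      has_derivative (\<lambda>h. snd (snd h) \<bullet> (K *v q))) (at w)"
    using has_derivative_mult_right[of _ _ _ "1/2"] by fastforce
  show ?thesis
    unfolding V_def DV_def using has_derivative_add[OF HH' quad'] by (simp add: x_def q_def)
qed

lemma DV_closed_loop:
  fixes wa :: "real^'m" and wu :: "real^'s" and wc :: "real^'m"
  defines "x \<equiv> (wa, wu)"
  defines "z \<equiv> grad_a H x + K *v wc"
  shows "DV (wa, wu, wc) (F (wa, wu, wc))
    = - (z \<bullet> (Rc1 x *v z)) - grad_u H x \<bullet> (Ruu x *v grad_u H x)"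
proof -
  define gu where "gu = grad_u H x"
  define a where "a = grad_a H x + dbar"
  define M where "M = Jc1 x - Rc1 x"
  define N where "N = Jau x + Rau x"
  have "z - a = K *v wc - K *v wc_bar" by (simp add: z_def a_def K_wc_bar)
  then have "DV (wa, wu, wc) (F (wa, wu, wc))
      = (M *v z + N *v gu) \<bullet> a + (- (transpose N *v a) + (Juu x - Ruu x) *v gu) \<bullet> gu
        + (M *v z) \<bullet> (z - a)"
    unfolding closed_loop_eq DV_def gu_def a_def M_def N_def z_def x_def
    by (simp add: matrix_vector_mult_diff_distrib)
  \<comment> \<open>the coupling terms through \<open>N\<close> and through \<open>M\<close> cancel; the skew parts contribute nothing\<close>
  also have "\<dots> = z \<bullet> (Jc1 x *v z) - z \<bullet> (Rc1 x *v z) + gu \<bullet> (Juu x *v gu) - gu \<bullet> (Ruu x *v gu)"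
    using inner_transpose_mult[of gu N a]
    by (simp add: M_def inner_add_left inner_add_right inner_diff_left inner_diff_right matrix_vector_mult_diff_rdistrib
        inner_commute)
  also have "\<dots> = - (z \<bullet> (Rc1 x *v z)) - gu \<bullet> (Ruu x *v gu)"
    using skew_quadratic_form[of "Jc1 x" z] skew_quadratic_form[of "Juu x" gu] J_skew Jc1_skew by simp
  finally show ?thesis by (simp add: gu_def)
qed

lemma DV_closed_loop_nonpos: "DV w (F w) \<le> 0"
proof -
  obtain wa wu wc where w: "w = (wa, wu, wc)" by (metis prod.collapse)
  define x where "x = (wa, wu)"
  have "0 \<le> grad_u H x \<bullet> (Ruu x *v grad_u H x)"
    using spec[OF spec[OF spec[OF R_psd, of x], of 0], of "grad_u H x"] by simp
  moreover have "0 \<le> z \<bullet> (Rc1 x *v z)" for z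
    using Rc1_pd pos_def_quadratic_form_nonneg by blast
  ultimately show ?thesis
    unfolding w DV_closed_loop x_def by (smt (verit))
qed

lemma F_continuous: "continuous_on UNIV F"
proof -
  let ?x = "\<lambda>w::(real^'m) \<times> (real^'s) \<times> (real^'m). (fst w, fst (snd w))"
  have "F = (\<lambda>w.
      ((Jc1 (?x w) - Rc1 (?x w)) *v (grad_a H (?x w) + K *v snd (snd w))
         + (Jau (?x w) + Rau (?x w)) *v grad_u H (?x w),
       - (transpose (Jau (?x w) + Rau (?x w)) *v (grad_a H (?x w) + dbar))
         + (Juu (?x w) - Ruu (?x w)) *v grad_u H (?x w),
       (Jc1 (?x w) - Rc1 (?x w)) *v (grad_a H (?x w) + K *v snd (snd w))))" (is "_ = ?G")
    by (simp add: fun_eq_iff closed_loop_eq split_paired_All)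
  moreover have "continuous_on UNIV ?G"
  proof -
    note cont = continuous_on_compose_plant_state[OF smooth_continuous_on]
    note smooth_H = smooth_imp_smooth_real[OF H_smooth]
    note grad_cont = continuous_on_compose_plant_state[OF grad_a_continuous_on[OF smooth_H]]
      continuous_on_compose_plant_state[OF grad_u_continuous_on[OF smooth_H]]
    have "continuous_on UNIV (\<lambda>w::(real^'m) \<times> (real^'s) \<times> (real^'m). snd (snd w))"
      by (intro continuous_intros)
    then show ?thesis
      by (intro continuous_on_Pair continuous_on_add continuous_on_diff continuous_on_minus
          continuous_on_matrix_vector_mult continuous_on_transpose continuous_on_const cont grad_cont
          smooth_J smooth_R smooth_c)
  qed
  ultimately show ?thesis by simp
qed

lemma F_wbar: "F wbar = 0"
  using grad_at_xbar K_wc_bar by (simp add: wbar_def closed_loop_eq zero_prod_def)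

lemma V_strict_min: "w \<noteq> wbar \<Longrightarrow> V wbar < V w"
proof -
  assume "w \<noteq> wbar"
  obtain wa wu wc where w: "w = (wa, wu, wc)" by (metis prod.collapse)
  have V_wbar: "V wbar = HH xbar" by (simp add: wbar_def V_def)
  show ?thesis
  proof (cases "(wa, wu) = xbar")
    case True
    then have "wc - wc_bar \<noteq> 0" using \<open>w \<noteq> wbar\<close> w wbar_def by auto
    then have "0 < (wc - wc_bar) \<bullet> (K *v (wc - wc_bar))"
      using pos_def_quadratic_form_nonneg[OF K_pos_def, of "wc - wc_bar"]
        pos_def_quadratic_form_eq_0_iff[OF K_pos_def, of "wc - wc_bar"] by linarith
    then show ?thesis unfolding w V_Pair V_wbar True by simp
  next
    case False
    then have "HH xbar < HH (wa, wu)" by (rule HH_strict_min)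
    moreover have "0 \<le> (wc - wc_bar) \<bullet> (K *v (wc - wc_bar))"
      using K_pos_def by (rule pos_def_quadratic_form_nonneg)
    ultimately show ?thesis unfolding w V_Pair V_wbar by simp
  qed
qed

sublocale lyapunov F V DV wbar
  using F_continuous V_has_derivative DV_closed_loop_nonpos V_strict_min by unfold_locales

lemma output_zero_if_dissipation_free:
  assumes "DV w (F w) = 0"
  shows "grad_a HH (fst w, fst (snd w)) + K *v (snd (snd w) - wc_bar) = 0"
proof -
  obtain wa wu wc where w: "w = (wa, wu, wc)" by (metis prod.collapse)
  define x where "x = (wa, wu)"
  define z where "z = grad_a H x + K *v wc"
  have "0 \<le> grad_u H x \<bullet> (Ruu x *v grad_u H x)"
    using spec[OF spec[OF spec[OF R_psd, of x], of 0], of "grad_u H x"] by simp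
  moreover have "0 \<le> z \<bullet> (Rc1 x *v z)"
    using Rc1_pd pos_def_quadratic_form_nonneg by blast
  moreover have "- (z \<bullet> (Rc1 x *v z)) - grad_u H x \<bullet> (Ruu x *v grad_u H x) = 0"
    using assms DV_closed_loop[of wa wu wc] by (simp add: w x_def z_def)
  ultimately have "z \<bullet> (Rc1 x *v z) = 0" by linarith
  then have "z = 0" using Rc1_pd pos_def_quadratic_form_eq_0_iff by blast
  then show ?thesis
    by (simp add: w grad_a_HH matrix_vector_mult_diff_distrib K_wc_bar x_def z_def)
qed

lemma V_sublevel_bounded:
  assumes "radially_unbounded HH"
  shows "bounded {w. V w \<le> M}"
proof -
  obtain l where l: "l > 0" "\<And>q. l * (norm q)\<^sup>2 \<le> q \<bullet> (K *v q)"
    using pos_def_quadratic_form_lower_bound[OF K_pos_def] by blast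
  have "\<forall>\<^sub>F x in at_infinity. M < HH x"
    using assms unfolding radially_unbounded_def filterlim_at_top_dense by blast
  then obtain b where b: "\<And>x. b \<le> norm x \<Longrightarrow> M < HH x"
    unfolding eventually_at_infinity by blast
  define \<rho> where "\<rho> = sqrt (2 * (M - HH xbar) / l)"
  define reassoc :: "((real^'m) \<times> (real^'s)) \<times> (real^'m) \<Rightarrow> (real^'m) \<times> (real^'s) \<times> (real^'m)"
    where "reassoc p = (fst (fst p), snd (fst p), snd p)" for p
  have sub: "{w. V w \<le> M} \<subseteq> reassoc ` (ball 0 b \<times> cball wc_bar \<rho>)"
  proof
    fix w assume "w \<in> {w. V w \<le> M}"
    moreover obtain wa wu wc where w: "w = (wa, wu, wc)" by (metis prod.collapse)
    ultimately have V: "HH (wa, wu) + (1/2) * ((wc - wc_bar) \<bullet> (K *v (wc - wc_bar))) \<le> M"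
      by (simp add: V_Pair)
    then have "HH (wa, wu) \<le> M"
      using pos_def_quadratic_form_nonneg[OF K_pos_def, of "wc - wc_bar"] by linarith
    then have "(wa, wu) \<in> ball 0 b" using b[of "(wa, wu)"] by force
    moreover have "l * (norm (wc - wc_bar))\<^sup>2 \<le> 2 * (M - HH xbar)"
      using V HH_min[of "(wa, wu)"] l(2)[of "wc - wc_bar"] by argo
    then have "wc \<in> cball wc_bar \<rho>"
      using l(1) by (simp add: \<rho>_def dist_norm norm_minus_commute real_le_rsqrt pos_le_divide_eq mult.commute)
    ultimately show "w \<in> reassoc ` (ball 0 b \<times> cball wc_bar \<rho>)"
      unfolding w reassoc_def by (intro image_eqI[of _ _ "((wa, wu), wc)"]) auto
  qed
  have "bounded (ball 0 b \<times> cball wc_bar \<rho>)"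
    by (intro bounded_Times bounded_ball bounded_cball)
  moreover have "bounded_linear reassoc"
    unfolding reassoc_def by (intro bounded_linear_intros)
  ultimately have "bounded (reassoc ` (ball 0 b \<times> cball wc_bar \<rho>))"
    by (rule bounded_linear_image)
  then show ?thesis using sub by (rule bounded_subset)
qed

end

theorem proposition3:
  fixes H :: "(real^'m) \<times> (real^'s) \<Rightarrow> real"
    and Jaa Raa Jc1 Rc1 :: "(real^'m) \<times> (real^'s) \<Rightarrow> real^'m^'m"
    and Jau Rau :: "(real^'m) \<times> (real^'s) \<Rightarrow> real^'s^'m"
    and Juu Ruu :: "(real^'m) \<times> (real^'s) \<Rightarrow> real^'s^'s"
    and K :: "real^'m^'m"
    and dbar :: "real^'m"
    and xbar :: "(real^'m) \<times> (real^'s)"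
  defines "HH \<equiv> (\<lambda>x. H x + fst x \<bullet> dbar)"
    and "F \<equiv> closed_loop Jaa Jau Juu Raa Rau Ruu Jc1 Rc1 K H dbar"
    and "wbar \<equiv> (fst xbar, snd xbar, matrix_inv K *v dbar)"
    and "Yu \<equiv> (\<lambda>w::(real^'m) \<times> (real^'s) \<times> (real^'m).
                 grad_a (\<lambda>x. H x + fst x \<bullet> dbar) (fst w, fst (snd w)) + K *v (snd (snd w) - matrix_inv K *v dbar))"
  assumes H_smooth: "smooth H" and H_nonneg: "\<forall>x. H x \<ge> 0"
    and smooth_J: "smooth Jaa" "smooth Jau" "smooth Juu"
    and smooth_R: "smooth Raa" "smooth Rau" "smooth Ruu"
    and smooth_c: "smooth Jc1" "smooth Rc1"
    and J_skew: "\<forall>x. skew (Jaa x) \<and> skew (Juu x)"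
    and R_sym: "\<forall>x. transpose (Raa x) = Raa x \<and> transpose (Ruu x) = Ruu x"
    and R_psd: "\<forall>x va vu. va \<bullet> (Raa x *v va) + va \<bullet> (Rau x *v vu)
                         + vu \<bullet> (transpose (Rau x) *v va) + vu \<bullet> (Ruu x *v vu) \<ge> 0"
    and argmin: "{x. \<forall>y. HH x \<le> HH y} = {xbar}"
    and K_pd: "sym_pd K"
    and Jc1_skew: "\<forall>x. skew (Jc1 x)"
    and Rc1_pd: "\<forall>x. pos_def (Rc1 x)"
  shows "(equilibrium F wbar \<and> stable F wbar)
       \<and> (detectable F Yu wbar \<longrightarrow> asymp_stable F wbar)
       \<and> (radially_unbounded HH \<longrightarrow>
            globally_stable F wbar \<and> (detectable F Yu wbar \<longrightarrow> globally_asymp_stable F wbar))"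
proof -
  interpret P: closed_loop_system H Jaa Raa Jc1 Rc1 Jau Rau Juu Ruu K dbar xbar
    using H_smooth smooth_J smooth_R smooth_c J_skew R_psd argmin K_pd Jc1_skew Rc1_pd
    unfolding HH_def by unfold_locales auto
  have HH: "HH = P.HH" and F: "F = P.F" and wbar: "wbar = P.wbar"
    unfolding HH_def F_def wbar_def P.wbar_def P.wc_bar_def by (auto simp: fun_eq_iff P.HH_def)
  have "P.dissipation_detectable" if "detectable F Yu wbar"
    using that P.output_zero_if_dissipation_free
    unfolding P.dissipation_detectable_def detectable_def F wbar Yu_def P.wc_bar_def
    by (simp add: HH[unfolded HH_def, symmetric])
  moreover have "bounded {w. P.V w \<le> M}" if "radially_unbounded HH" for M
    using P.V_sublevel_bounded that unfolding HH .
  moreover have "equilibrium F wbar"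
    unfolding equilibrium_def F wbar by (rule P.F_wbar)
  ultimately show ?thesis
    unfolding F wbar
    using P.stable P.asymp_stable P.globally_stable P.globally_asymp_stable by blast
qed

end
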